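(* Let $n\ge 1$ and let $f\in L^1(\mathbb{R}^n)$ satisfy, for some constant $C_0>0$ and some $0<a<1$, the estimates $$|f(x)|\le C_0\, e^{-\frac12 a|x|^2},\qquad |\hat f(x)|\le C_0\, e^{-\frac12 a|x|^2}\qquad (x\in\mathbb{R}^n).$$ Let $s>0$ be determined by $\tanh(2s)=a/2$. Then there is a constant $C>0$, independent of $k$, such that for all $k=0,1,2,\dots$ $$\|P_kf\|_2\le C\,(2k+n)^{\frac{n-1}{4}}\,e^{-(2k+n)s/2}.$$
   Context: The Fourier transform is $\hat f(\xi)=(2\pi)^{-n/2}\int_{\mathbb{R}^n}f(x)e^{-ix\cdot\xi}\,dx$. For $\alpha\in\mathbb{N}^n$ ($\mathbb{N}$ includes $0$), $\Phi_\alpha$ denotes the normalised Hermite function $\Phi_\alpha(x)=\prod_{j=1}^n h_{\alpha_j}(x_j)$, where $h_k(t)=(2^kk!\sqrt{\pi})^{-1/2}H_k(t)e^{-t^2/2}$ and $H_k$ is the $k$-th (physicists') Hermite polynomial; the $\Phi_\alpha$ form an orthonormal basis of $L^2(\mathbb{R}^n)$ of eigenfunctions of $-\Delta+|x|^2$ with eigenvalues $2|\alpha|+n$. For $f\in L^2(\mathbb{R}^n)$, $P_kf=\sum_{|\alpha|=k}(f,\Phi_\alpha)\Phi_\alpha$, with $(\cdot,\cdot)$ the $L^2(\mathbb{R}^n)$ inner product. *)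

theory Defs
  imports "HOL-Analysis.Analysis"
begin

(* Rodrigues' formula for the physicists' Hermite polynomials, as a function on the reals *)
definition hermite_H :: "nat \<Rightarrow> real \<Rightarrow> real" where
  "hermite_H k t = (-1) ^ k * exp (t\<^sup>2) * (deriv ^^ k) (\<lambda>u. exp (- u\<^sup>2)) t"

definition hermite_h :: "nat \<Rightarrow> real \<Rightarrow> real" where
  "hermite_h k t = hermite_H k t * exp (- t\<^sup>2 / 2) / sqrt (2 ^ k * fact k * sqrt pi)"

definition hermite_fun :: "('n::finite \<Rightarrow> nat) \<Rightarrow> real ^ 'n \<Rightarrow> real" where
  "hermite_fun \<alpha> x = (\<Prod>j\<in>UNIV. hermite_h (\<alpha> j) (x $ j))"

definition multi_indices :: "nat \<Rightarrow> ('n::finite \<Rightarrow> nat) set" where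
  "multi_indices k = {\<alpha>. (\<Sum>j\<in>UNIV. \<alpha> j) = k}"

(* The sum in hermite_proj below is therefore a genuine finite sum. *)
lemma finite_multi_indices: "finite (multi_indices k :: ('n::finite \<Rightarrow> nat) set)"
proof (rule finite_subset)
  show "(multi_indices k :: ('n \<Rightarrow> nat) set) \<subseteq> PiE UNIV (\<lambda>_. {..k})"
    by (auto simp: multi_indices_def PiE_def intro!: member_le_sum)
  show "finite (PiE (UNIV :: 'n set) (\<lambda>_. {..k}))"
    by (intro finite_PiE) auto
qed

definition fourier :: "(real ^ 'n::finite \<Rightarrow> complex) \<Rightarrow> real ^ 'n \<Rightarrow> complex" where
  "fourier f \<xi> = complex_of_real ((2 * pi) powr (- real CARD('n) / 2)) *
     (LINT x|lebesgue. f x * exp (- \<i> * complex_of_real (x \<bullet> \<xi>)))"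

definition L2_inner :: "(real ^ 'n::finite \<Rightarrow> complex) \<Rightarrow> (real ^ 'n \<Rightarrow> complex) \<Rightarrow> complex" where
  "L2_inner f g = (LINT x|lebesgue. f x * cnj (g x))"

(* The Bochner integral is 0 for non-integrable integrands, so this is the L2 norm only on
   square-integrable functions; every hermite_proj k f is one, being a finite linear
   combination of Hermite functions. *)
definition L2_norm :: "(real ^ 'n::finite \<Rightarrow> complex) \<Rightarrow> real" where
  "L2_norm g = sqrt (LINT x|lebesgue. (cmod (g x))\<^sup>2)"

definition hermite_proj ::
    "nat \<Rightarrow> (real ^ 'n::finite \<Rightarrow> complex) \<Rightarrow> real ^ 'n \<Rightarrow> complex" where
  "hermite_proj k f x = (\<Sum>\<alpha>\<in>multi_indices k.
     L2_inner f (\<lambda>y. complex_of_real (hermite_fun \<alpha> y)) * complex_of_real (hermite_fun \<alpha> x))"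

end

theory Submission
  imports Defs "HOL-Probability.Probability" "HOL-Complex_Analysis.Complex_Analysis"
    "HOL-Real_Asymp.Real_Asymp"
begin

unbundle no Formal_Power_Series.fps_syntax

text \<open>Integrating \<open>f\<close> against a product of the generating functions of the Hermite functions gives
  an entire function on \<open>\<complex>\<^sup>n\<close> (the Bargmann transform), whose Taylor coefficients are, up to
  normalisation, the Hermite coefficients of \<open>f\<close>. The Gaussian bound on \<open>f\<close> controls its growth by
  \<open>exp (\<Sum>\<^sub>j (2 / (1 + a) - 1) p\<^sub>j\<^sup>2 + q\<^sub>j\<^sup>2)\<close> at \<open>z = p + \<i> q\<close>. The transform of the Fourier
  transform of \<open>f\<close> is that of \<open>f\<close> rotated by \<open>\<i>\<close>, so the same bound holds with \<open>p\<close> and \<open>q\<close>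
  interchanged. The geometric mean of both bounds is \<open>exp (\<bar>z\<bar>\<^sup>2 / (1 + a))\<close>, and Cauchy's estimates
  on polydiscs of optimal radii bound the Hermite coefficients of order \<open>k\<close> by a polynomial in
  \<open>k\<close> times \<open>(1 + a)\<^bsup>-k/2\<^esup>\<close>. Since \<open>tanh (2 s) = a / 2\<close> gives \<open>(1 + a)\<^bsup>-1/2\<^esup> < exp (- s)\<close> strictly,
  all polynomial factors, including the number of multi-indices of order \<open>k\<close>, are absorbed, and
  neither the orthogonality of the Hermite functions nor their exact norms matter.\<close>

section \<open>Gaussian integrals, integrals of products, and exchange of integrals\<close>

text \<open>With \<open>b = p + \<i> * q\<close>, the substitution
  \<open>x = p / c + y / sqrt c\<close> completes the square for the real part of the linear term.
  What remains is the characteristic function of the standard normal distribution at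
  \<open>q / sqrt c\<close>, so that no contour has to be shifted.\<close>

lemma has_bochner_integral_gaussian:
  fixes b :: complex and c :: real
  assumes c: "c > 0"
  shows "has_bochner_integral lborel (\<lambda>x. exp (- complex_of_real (c * x\<^sup>2 / 2) + b * of_real x))
           (complex_of_real (sqrt (2 * pi / c)) * exp (b\<^sup>2 / of_real (2 * c)))"
proof -
  have std: "has_bochner_integral lborel (\<lambda>y. std_normal_density y *\<^sub>R iexp (t * y))
               (complex_of_real (exp (- t\<^sup>2 / 2)))" for t
  proof -
    interpret real_distribution std_normal_distribution
      by (rule real_dist_normal_dist)
    have "has_bochner_integral std_normal_distribution (\<lambda>y. iexp (t * y)) (char std_normal_distribution t)"
      unfolding char_def by (rule has_bochner_integral_integrable) (rule integrable_iexp, auto)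
    then show ?thesis
      by (simp add: char_std_normal_distribution has_bochner_integral_iff integrable_density integral_density)
  qed
  define p where "p = Re b"
  define q where "q = Im b"
  have b: "b = Complex p q" by (simp add: p_def q_def)
  \<comment> \<open>\<open>D\<close> collects what does not depend on \<open>y\<close> after the
    substitution; \<open>sqrt (2 * pi)\<close> cancels the normalisation of the density.\<close>
  define D where "D = complex_of_real (sqrt (2 * pi)) * exp (of_real (p\<^sup>2 / (2 * c)) + \<i> * of_real (q * p / c))"
  have sq: "sqrt c > 0" "sqrt c * sqrt c = c" using c by auto
  have eq: "D * (std_normal_density y *\<^sub>R iexp (q / sqrt c * y)) =
      exp (- complex_of_real (c * (p / c + 1 / sqrt c * y)\<^sup>2 / 2) + b * of_real (p / c + 1 / sqrt c * y))" for y
  proof -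
    have e: "complex_of_real (p\<^sup>2 / (2 * c)) + \<i> * of_real (q * p / c) + of_real (- y\<^sup>2 / 2) + \<i> * of_real (q / sqrt c * y)
      = - complex_of_real (c * (p / c + 1 / sqrt c * y)\<^sup>2 / 2) + b * of_real (p / c + 1 / sqrt c * y)"
    proof (rule complex_eqI)
      have "(p / c + y / sqrt c)\<^sup>2 = p\<^sup>2 / c\<^sup>2 + 2 * p * y / (c * sqrt c) + y\<^sup>2 / c"
        using c by (simp add: power2_sum power_divide)
      then show "Re (complex_of_real (p\<^sup>2 / (2 * c)) + \<i> * of_real (q * p / c) + of_real (- y\<^sup>2 / 2) + \<i> * of_real (q / sqrt c * y))
      = Re (- complex_of_real (c * (p / c + 1 / sqrt c * y)\<^sup>2 / 2) + b * of_real (p / c + 1 / sqrt c * y))"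
        using c by (simp add: b field_simps power2_eq_square)
      show "Im (complex_of_real (p\<^sup>2 / (2 * c)) + \<i> * of_real (q * p / c) + of_real (- y\<^sup>2 / 2) + \<i> * of_real (q / sqrt c * y))
      = Im (- complex_of_real (c * (p / c + 1 / sqrt c * y)\<^sup>2 / 2) + b * of_real (p / c + 1 / sqrt c * y))"
        using c by (simp add: b field_simps)
    qed
    have "D * (std_normal_density y *\<^sub>R iexp (q / sqrt c * y)) =
       exp (of_real (p\<^sup>2 / (2 * c)) + \<i> * of_real (q * p / c)) * exp (of_real (- y\<^sup>2 / 2)) * exp (\<i> * of_real (q / sqrt c * y))"
      unfolding D_def std_normal_density_def scaleR_conv_of_real exp_of_real by simp
    also have "\<dots> = exp (complex_of_real (p\<^sup>2 / (2 * c)) + \<i> * of_real (q * p / c) + of_real (- y\<^sup>2 / 2) + \<i> * of_real (q / sqrt c * y))"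
      by (simp only: exp_add)
    finally show ?thesis unfolding e .
  qed
  have val: "(complex_of_real (sqrt (2 * pi / c)) * exp (b\<^sup>2 / of_real (2 * c))) /\<^sub>R \<bar>1 / sqrt c\<bar>
      = D * complex_of_real (exp (- (q / sqrt c)\<^sup>2 / 2))"
  proof -
    have "b\<^sup>2 / of_real (2 * c) = of_real (p\<^sup>2 / (2 * c)) + \<i> * of_real (q * p / c) + of_real (- (q / sqrt c)\<^sup>2 / 2)"
      using c by (simp add: b complex_eq_iff power2_eq_square field_simps)
    then have "exp (b\<^sup>2 / of_real (2 * c)) =
        exp (of_real (p\<^sup>2 / (2 * c)) + \<i> * of_real (q * p / c)) * of_real (exp (- (q / sqrt c)\<^sup>2 / 2))"
      by (simp only: exp_add exp_of_real)
    then show ?thesis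
      using sq unfolding D_def by (simp add: real_sqrt_divide scaleR_conv_of_real)
  qed
  have "1 / sqrt c \<noteq> 0" using sq by simp
  then show ?thesis
    using has_bochner_integral_mult_right[OF std[of "q / sqrt c"], of D]
    unfolding eq val [symmetric]
    by (rule iffD2[OF lborel_has_bochner_integral_real_affine_iff[where t="p / c"]])
qed

text \<open>\<open>lborel\<close> on \<open>real ^ 'n\<close> is the image of a product measure
  indexed by \<open>Basis\<close>, and \<open>axis j 1\<close> runs through \<open>Basis\<close>
  exactly once as \<open>j\<close> runs through \<open>'n\<close>. This reduces all integrals over
  the whole space to one variable.\<close>

lemma has_bochner_integral_lborel_prod_vec:
  fixes g :: "'n::finite \<Rightarrow> real \<Rightarrow> 'b::{real_normed_field,banach,second_countable_topology}"
  assumes g: "\<And>j. has_bochner_integral lborel (g j) (I j)"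
  shows "has_bochner_integral lborel (\<lambda>x::real^'n. \<Prod>j\<in>UNIV. g j (x $ j)) (\<Prod>j\<in>UNIV. I j)"
proof -
  interpret product_sigma_finite "\<lambda>_::real^'n. lborel :: real measure" by standard
  have B: "Basis = range (\<lambda>j::'n. axis j (1::real))" by (auto simp: Basis_vec_def)
  have inj: "inj (\<lambda>j::'n. axis j (1::real))" by (auto simp: inj_on_def axis_eq_axis)
  define ix where "ix = inv (\<lambda>j::'n. axis j (1::real))"
  have ix: "ix (axis j 1) = j" for j by (simp add: ix_def inv_f_f[OF inj])
  have int: "integrable lborel (g j)" and I: "I j = integral\<^sup>L lborel (g j)" for j
    using g[of j] by (auto simp: has_bochner_integral_iff)
  have [measurable]: "g j \<in> borel_measurable borel" for j
    using int[of j] by (simp add: borel_measurable_integrable)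
  have PiM: "has_bochner_integral (\<Pi>\<^sub>M b\<in>Basis. lborel) (\<lambda>x. \<Prod>b\<in>Basis. g (ix b) (x b)) (\<Prod>b\<in>Basis. I (ix b))"
    unfolding has_bochner_integral_iff I
    by (intro conjI product_integrable_prod product_integral_prod int) auto
  have reindex: "(\<Prod>b\<in>Basis. F (ix b) b) = (\<Prod>j\<in>UNIV. F j (axis j 1))" for F :: "'n \<Rightarrow> real^'n \<Rightarrow> 'b"
    unfolding B by (subst prod.reindex[OF inj]) (simp add: ix)
  have nth: "(\<Sum>b\<in>Basis. x b *\<^sub>R b) $ j = x (axis j 1)" for x :: "real^'n \<Rightarrow> real" and j
  proof -
    have "(\<Sum>b\<in>Basis. x b *\<^sub>R b) $ j = (\<Sum>b\<in>Basis. x b *\<^sub>R b) \<bullet> axis j 1"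
      by (simp add: inner_axis)
    also have "\<dots> = x (axis j 1)"
      by (rule inner_sum_left_Basis) (auto simp: B)
    finally show ?thesis .
  qed
  have "has_bochner_integral (\<Pi>\<^sub>M b\<in>Basis. lborel)
      (\<lambda>x. \<Prod>j\<in>UNIV. g j ((\<Sum>b\<in>Basis. x b *\<^sub>R b) $ j)) (\<Prod>j\<in>UNIV. I j)"
    using PiM unfolding nth by (simp only: reindex[of "\<lambda>j b. g j (_ b)"] reindex[of "\<lambda>j b. I j"])
  then show ?thesis
    by (subst lborel_eq, intro has_bochner_integral_distr) auto
qed

lemma sigma_finite_measure_lebesgue: "sigma_finite_measure (lebesgue :: 'a::euclidean_space measure)"
proof -
  obtain A :: "'a set set" where A: "countable A" "A \<subseteq> sets lborel" "\<Union>A = space lborel" "\<forall>a\<in>A. emeasure lborel a \<noteq> \<infinity>"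
    using lborel.sigma_finite_countable by blast
  show ?thesis
    using A by (intro sigma_finite_measure.intro exI[of _ A]) (auto simp: subset_iff)
qed

text \<open>The integrand is dominated by \<open>B * norm (f x * g y)\<close>, which is integrable
  on the product space, so Fubini applies. The kernel will be the Fourier kernel in one case and the
  Hermite kernel on a torus in the other.\<close>

lemma integral_bounded_kernel_swap:
  fixes f :: "'a \<Rightarrow> complex" and g :: "'b \<Rightarrow> complex" and k :: "'a \<Rightarrow> 'b \<Rightarrow> complex"
  assumes "sigma_finite_measure M" "sigma_finite_measure N"
    and f: "integrable M f" and g: "integrable N g"
    and k [measurable]: "(\<lambda>(x, y). k x y) \<in> borel_measurable (M \<Otimes>\<^sub>M N)"
    and bd: "\<And>x y. x \<in> space M \<Longrightarrow> y \<in> space N \<Longrightarrow> norm (k x y) \<le> B"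
  shows "(LINT x|M. f x * (LINT y|N. k x y * g y)) = (LINT y|N. (LINT x|M. f x * k x y) * g y)"
proof -
  interpret M: sigma_finite_measure M by fact
  interpret N: sigma_finite_measure N by fact
  interpret pair_sigma_finite M N ..
  note [measurable] = borel_measurable_integrable[OF f] borel_measurable_integrable[OF g]
  have fg: "integrable (M \<Otimes>\<^sub>M N) (\<lambda>(x, y). f x * g y)"
    by (rule Fubini_integrable) (auto simp: norm_mult f g intro!: integrable_mult_left integrable_mult_right)
  have "integrable (M \<Otimes>\<^sub>M N) (\<lambda>(x, y). f x * k x y * g y)"
    using fg[THEN integrable_norm, THEN integrable_mult_right, of B]
  proof (rule Bochner_Integration.integrable_bound)
    have "norm (f x * k x y * g y) \<le> norm (B * norm (f x * g y))" if "x \<in> space M" "y \<in> space N" for x y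
    proof -
      have "norm (k x y) * norm (f x * g y) \<le> B * norm (f x * g y)"
        by (intro mult_right_mono bd that) auto
      also have "\<dots> \<le> norm (B * norm (f x * g y))" by simp
      finally show ?thesis by (simp add: norm_mult mult_ac)
    qed
    then show "AE z in M \<Otimes>\<^sub>M N. norm (case z of (x, y) \<Rightarrow> f x * k x y * g y)
        \<le> norm (B * norm (case z of (x, y) \<Rightarrow> f x * g y))"
      by (intro AE_I2) (auto simp: space_pair_measure)
  qed measurable
  from Fubini_integral[OF this] show ?thesis
    by (simp add: mult.assoc flip: integral_mult_left_zero integral_mult_right_zero)
qed

section \<open>A weak Stirling bound and the radius for Cauchy's estimate\<close>

text \<open>Induction on \<open>m\<close>: the step amounts to
  \<open>(1 + 1 / m) ^ (m + 1) \<ge> exp 1\<close>, which follows from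
  \<open>ln u \<le> u - 1\<close> at \<open>u = 1 / (1 + 1 / m)\<close>.\<close>

lemma fact_le_power_exp: "fact m * exp (real m) \<le> exp 1 * real m ^ m * real m" if "m \<ge> 1"
  using that
proof (induction m rule: dec_induct)
  case base
  then show ?case by simp
next
  case (step m)
  have m: "real m > 0" using step by simp
  have "1 / (1 + 1 / real m) * (1 / real m) \<le> ln (1 + 1 / real m)"
    using ln_le_minus_one[of "1 / (1 + 1 / real m)"] m
    by (simp add: ln_div field_simps)
  then have "1 \<le> real (Suc m) * ln (1 + 1 / real m)"
    using m by (simp add: field_simps)
  then have "exp 1 \<le> exp (real (Suc m) * ln (1 + 1 / real m))" by simp
  also have "\<dots> = (1 + 1 / real m) ^ Suc m"
    using m by (subst exp_of_nat_mult) (simp add: add_pos_pos)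
  also have "1 + 1 / real m = real (Suc m) / real m" using m by (simp add: field_simps)
  finally have e: "exp 1 * real m ^ Suc m \<le> real (Suc m) ^ Suc m"
    using m by (simp add: power_divide field_simps)
  have "fact (Suc m) * exp (real (Suc m)) = (real (Suc m) * exp 1) * (fact m * exp (real m))"
    by (simp add: exp_add)
  also have "\<dots> \<le> (real (Suc m) * exp 1) * (exp 1 * real m ^ m * real m)"
    using step.IH by (intro mult_left_mono) auto
  also have "\<dots> = real (Suc m) * exp 1 * (exp 1 * real m ^ Suc m)" by simp
  also have "\<dots> \<le> real (Suc m) * exp 1 * real (Suc m) ^ Suc m"
    by (intro mult_left_mono e) auto
  finally show ?case by (simp add: mult_ac)
qed

text \<open>The left side is Cauchy's estimate for a coefficient of order \<open>m\<close> under
  growth \<open>exp (b * \<rho>\<^sup>2)\<close>, times the normalisation of the Hermite function up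
  to a power of \<open>pi\<close>. It is smallest at \<open>\<rho>\<^sup>2 = m / (2 * b)\<close>;
  taking \<open>m + 1\<close> instead keeps the radius positive for \<open>m = 0\<close> and fits
  \<open>fact_le_power_exp\<close> at \<open>Suc m\<close>.\<close>

lemma hermite_radius:
  fixes b :: real
  assumes b: "b > 0"
  obtains \<rho> where "\<rho> > 0" "\<rho>\<^sup>2 = (real m + 1) / (2 * b)"
    "sqrt (fact m / 2 ^ m) / \<rho> ^ m * exp (b * \<rho>\<^sup>2) \<le> sqrt (exp 1 * (real m + 1)) * sqrt b ^ m"
proof -
  define \<rho> where "\<rho> = sqrt ((real m + 1) / (2 * b))"
  have \<rho>: "\<rho> > 0" "\<rho>\<^sup>2 = (real m + 1) / (2 * b)" using b by (auto simp: \<rho>_def)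
  have "sqrt (fact m / 2 ^ m) / \<rho> ^ m * exp (b * \<rho>\<^sup>2) \<le> sqrt (exp 1 * (real m + 1) * b ^ m)"
  proof (rule real_le_rsqrt)
    have "(sqrt (fact m / 2 ^ m) / \<rho> ^ m * exp (b * \<rho>\<^sup>2))\<^sup>2 = fact m / 2 ^ m / (\<rho>\<^sup>2) ^ m * exp (2 * (b * \<rho>\<^sup>2))"
    proof -
      have "(\<rho> ^ m)\<^sup>2 = (\<rho>\<^sup>2) ^ m" by (metis power_mult mult.commute)
      then show ?thesis by (simp add: power_mult_distrib power_divide exp_double)
    qed
    also have "2 * (b * \<rho>\<^sup>2) = real (Suc m)" using b by (simp add: \<rho>)
    also have "fact m / 2 ^ m / (\<rho>\<^sup>2) ^ m * exp (real (Suc m)) = b ^ m / (real m + 1) ^ Suc m * (fact (Suc m) * exp (real (Suc m)))"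
    proof -
      have "fact m / 2 ^ m / (N / (2 * b)) ^ m * E = b ^ m / N ^ Suc m * (N * fact m * E)" if "N > 0" for N E :: real
        using b that by (simp add: power_divide power_mult_distrib)
      from this[of "real m + 1"] show ?thesis unfolding \<rho>(2) fact_Suc by (simp add: add.commute)
    qed
    also have "\<dots> \<le> b ^ m / (real m + 1) ^ Suc m * (exp 1 * real (Suc m) ^ Suc m * real (Suc m))"
      using b by (intro mult_left_mono fact_le_power_exp) auto
    also have "\<dots> = exp 1 * (real m + 1) * b ^ m" by (simp add: add.commute)
    finally show "(sqrt (fact m / 2 ^ m) / \<rho> ^ m * exp (b * \<rho>\<^sup>2))\<^sup>2 \<le> exp 1 * (real m + 1) * b ^ m" .
  qed
  then show ?thesis using \<rho> by (intro that) (auto simp: real_sqrt_mult real_sqrt_power)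
qed

section \<open>Hermite functions as circle means of their generating function\<close>

text \<open>Rodrigues' formula uses iterated real derivatives, Cauchy's formula complex ones. Along
  the real axis the complex derivative is a vector derivative, and its imaginary part is the
  derivative of the constant 0.\<close>

lemma higher_deriv_complex_of_real:
  fixes f :: "real \<Rightarrow> real" and F :: "complex \<Rightarrow> complex"
  assumes F: "F holomorphic_on UNIV" and eq: "\<And>u. F (of_real u) = of_real (f u)"
  shows "(deriv ^^ k) F (of_real t) = of_real ((deriv ^^ k) f t)"
proof (induction k arbitrary: t)
  case 0
  then show ?case by (simp add: eq)
next
  case (Suc k)
  define G where "G = (deriv ^^ k) F"
  define h where "h = (deriv ^^ k) f"
  have "G holomorphic_on UNIV" unfolding G_def by (intro holomorphic_higher_deriv F) auto
  then have "(G has_field_derivative deriv G (of_real t)) (at (of_real t))"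
    by (metis UNIV_I holomorphic_derivI open_UNIV)
  then have "((\<lambda>u. G (of_real u)) has_vector_derivative deriv G (of_real t)) (at t)"
    by (rule has_vector_derivative_real_field)
  then have *: "((\<lambda>u. complex_of_real (h u)) has_vector_derivative deriv G (of_real t)) (at t)"
    using Suc.IH by (simp add: G_def h_def)
  have "(h has_vector_derivative Re (deriv G (of_real t))) (at t)"
    using bounded_linear.has_vector_derivative[OF bounded_linear_Re *] by simp
  then have "deriv h t = Re (deriv G (of_real t))"
    by (simp add: has_real_derivative_iff_has_vector_derivative DERIV_imp_deriv)
  moreover have "((\<lambda>u::real. 0::real) has_vector_derivative Im (deriv G (of_real t))) (at t)"
    using bounded_linear.has_vector_derivative[OF bounded_linear_Im *] by simp
  then have "Im (deriv G (of_real t)) = 0"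
    using vector_derivative_unique_at has_vector_derivative_const by blast
  ultimately have "deriv G (of_real t) = of_real (deriv h t)"
    by (simp add: complex_eq_iff)
  then show ?case by (simp add: G_def h_def)
qed

text \<open>The parameter space of a circle, as a probability space: circle means become
  expectations, and means over a torus become integrals over a finite product of copies.\<close>

definition unit_interval :: "real measure" where
  "unit_interval = restrict_space lborel {0..1}"

lemma prob_space_unit_interval: "prob_space unit_interval"
  unfolding unit_interval_def by (rule prob_space_restrict_space) auto

lemma borel_measurable_unit_interval [measurable (raw)]:
  "g \<in> borel_measurable borel \<Longrightarrow> g \<in> borel_measurable unit_interval"
  unfolding unit_interval_def by (rule measurable_restrict_space1) simp

definition circle_point :: "real \<Rightarrow> real \<Rightarrow> complex" where
  "circle_point \<rho> \<theta> = of_real \<rho> * exp (2 * of_real pi * \<i> * of_real \<theta>)"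

lemma cmod_circle_point: "\<rho> \<ge> 0 \<Longrightarrow> cmod (circle_point \<rho> \<theta>) = \<rho>"
  by (simp add: circle_point_def norm_mult)

lemma measurable_circle_point [measurable]: "circle_point \<rho> \<in> borel_measurable borel"
  unfolding circle_point_def
  by (intro borel_measurable_continuous_onI continuous_intros)

text \<open>The exponential generating function of \<open>(-1)\<^sup>k H\<^sub>k(t) exp (- t\<^sup>2 / 2)\<close>; with \<open>w = - sqrt 2 * z\<close> it is a
  multiple of the Bargmann kernel.\<close>

definition hermite_kernel :: "complex \<Rightarrow> real \<Rightarrow> complex" where
  "hermite_kernel z t = exp (- 2 * of_real t * z - z\<^sup>2 - of_real (t\<^sup>2 / 2))"

lemma measurable_hermite_kernel [measurable (raw)]:
  assumes [measurable]: "z \<in> borel_measurable M" "t \<in> borel_measurable M"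
  shows "(\<lambda>x. hermite_kernel (z x) (t x)) \<in> borel_measurable M"
proof -
  have [measurable]: "(exp :: complex \<Rightarrow> complex) \<in> borel_measurable borel"
    by (intro borel_measurable_continuous_onI continuous_intros)
  show ?thesis unfolding hermite_kernel_def by measurable
qed

lemma cmod_hermite_kernel:
  "cmod (hermite_kernel z t) = exp (- 2 * t * Re z - (Re z)\<^sup>2 + (Im z)\<^sup>2 - t\<^sup>2 / 2)"
  by (simp add: hermite_kernel_def Re_power2)

text \<open>Completing the square in \<open>t\<close> gives both a bound uniform in \<open>t\<close>
  and Gaussian decay around \<open>t = - 2 * Re z\<close>.\<close>

lemma cmod_hermite_kernel_square:
  "cmod (hermite_kernel z t) = exp ((cmod z)\<^sup>2 - (2 * Re z + t)\<^sup>2 / 2)"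
  unfolding cmod_hermite_kernel cmod_power2 by (simp add: power2_eq_square algebra_simps)

lemma cmod_hermite_kernel_le: "cmod (hermite_kernel z t) \<le> exp ((cmod z)\<^sup>2)"
  by (simp add: cmod_hermite_kernel_square)

text \<open>Rodrigues' formula expresses \<open>H\<^sub>k(t)\<close> by the \<open>k\<close>-th
  derivative of \<open>exp (- u\<^sup>2)\<close> at \<open>t\<close>, and Cauchy's integral formula
  writes this derivative as a mean over a circle about \<open>t\<close>. The radius is free because
  the function is entire.\<close>

lemma hermite_h_eq_circle_mean:
  assumes \<rho>: "\<rho> > 0"
  shows "complex_of_real (hermite_h k t) = of_real (sqrt (fact k / (2 ^ k * sqrt pi))) *
    (LINT \<theta>|unit_interval. hermite_kernel (circle_point \<rho> \<theta>) t * (1 / (- circle_point \<rho> \<theta>) ^ k))"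
proof -
  define F where "F = (\<lambda>u::complex. exp (- u\<^sup>2))"
  \<comment> \<open>This is the Cauchy integrand up to \<open>2 * pi * \<i>\<close>: the derivative
    of the path contributes one factor \<open>circle_point \<rho> \<theta>\<close>, which lowers the
    exponent from \<open>Suc k\<close> to \<open>k\<close>.\<close>
  define E where "E = (\<lambda>\<theta>. exp (- (of_real t + circle_point \<rho> \<theta>)\<^sup>2) / circle_point \<rho> \<theta> ^ k)"
  have F: "F holomorphic_on UNIV" unfolding F_def by (intro holomorphic_intros)
  have nz: "circle_point \<rho> \<theta> \<noteq> 0" for \<theta> using \<rho> by (simp add: circle_point_def)
  define D where "D = (deriv ^^ k) (\<lambda>u::real. exp (- u\<^sup>2)) t"
  have D: "(deriv ^^ k) F (of_real t) = of_real D"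
    unfolding D_def by (rule higher_deriv_complex_of_real[OF F]) (simp add: F_def exp_of_real [symmetric])
  have contE: "continuous_on {0..1} E"
    unfolding E_def using nz by (intro continuous_intros) (auto simp: circle_point_def intro!: continuous_intros)
  have "((\<lambda>u. F u / (u - of_real t) ^ Suc k) has_contour_integral (2 * pi * \<i> / fact k * of_real D))
      (circlepath (of_real t) \<rho>)"
    unfolding D [symmetric]
    using \<rho> by (intro Cauchy_has_contour_integral_higher_derivative_circlepath holomorphic_on_imp_continuous_on
       holomorphic_on_subset[OF F]) auto
  then have "((\<lambda>\<theta>. F (circlepath (of_real t) \<rho> \<theta>) / (circlepath (of_real t) \<rho> \<theta> - of_real t) ^ Suc k
        * vector_derivative (circlepath (of_real t) \<rho>) (at \<theta> within {0..1})) has_integral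
       (2 * pi * \<i> / fact k * of_real D)) {0..1}"
    by (simp add: has_contour_integral_def)
  then have "((\<lambda>\<theta>. 2 * pi * \<i> * E \<theta>) has_integral (2 * pi * \<i> / fact k * of_real D)) {0..1}"
  proof (rule has_integral_eq [rotated])
    fix \<theta> :: real assume "\<theta> \<in> {0..1}"
    moreover have "circlepath (of_real t) \<rho> \<theta> = of_real t + circle_point \<rho> \<theta>"
      by (simp add: circlepath circle_point_def)
    ultimately show "F (circlepath (of_real t) \<rho> \<theta>) / (circlepath (of_real t) \<rho> \<theta> - of_real t) ^ Suc k
        * vector_derivative (circlepath (of_real t) \<rho>) (at \<theta> within {0..1}) = 2 * pi * \<i> * E \<theta>"
      using nz[of \<theta>] by (simp add: vector_derivative_circlepath01 E_def F_def) (simp add: circle_point_def)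
  qed
  then have "((\<lambda>\<theta>. (1 / (2 * pi * \<i>)) * (2 * pi * \<i> * E \<theta>)) has_integral (1 / (2 * pi * \<i>)) * (2 * pi * \<i> / fact k * of_real D)) {0..1}"
    by (rule has_integral_mult_right)
  then have "(E has_integral (of_real D / fact k)) {0..1}" by simp
  moreover have "(LINT \<theta>|unit_interval. E \<theta>) = integral {0..1} E"
    using set_borel_integral_eq_integral(2)[OF borel_integrable_atLeastAtMost'[OF contE]]
    unfolding unit_interval_def set_lebesgue_integral_def by (simp add: integral_restrict_space)
  ultimately have mean: "(LINT \<theta>|unit_interval. E \<theta>) = of_real D / fact k"
    by (simp add: integral_unique)
  \<comment> \<open>The minus sign under the power carries the \<open>(-1) ^ k\<close> of Rodrigues'
    formula, and \<open>exp (t\<^sup>2 / 2)\<close> is what its factor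
    \<open>exp (t\<^sup>2)\<close> leaves after the weight
    \<open>exp (- t\<^sup>2 / 2)\<close>.\<close>
  have "hermite_kernel (circle_point \<rho> \<theta>) t * (1 / (- circle_point \<rho> \<theta>) ^ k) =
      ((-1) ^ k * exp (of_real (t\<^sup>2 / 2))) * E \<theta>" for \<theta>
  proof -
    have "- 2 * of_real t * z - z\<^sup>2 - of_real (t\<^sup>2 / 2) = of_real (t\<^sup>2 / 2) + (- (of_real t + z)\<^sup>2)" for z :: complex
      by (simp add: power2_eq_square algebra_simps)
    then have "hermite_kernel z t = exp (of_real (t\<^sup>2 / 2)) * exp (- (of_real t + z)\<^sup>2)" for z
      by (simp only: hermite_kernel_def exp_add)
    moreover have "1 / (- z) ^ k = (-1) ^ k / z ^ k" for z :: complex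
      by (cases "even k") auto
    ultimately show ?thesis by (simp add: E_def)
  qed
  then have "(LINT \<theta>|unit_interval. hermite_kernel (circle_point \<rho> \<theta>) t * (1 / (- circle_point \<rho> \<theta>) ^ k)) =
      of_real ((-1) ^ k * exp (t\<^sup>2 / 2) * D / fact k)"
    by (simp add: mean exp_of_real [symmetric])
  moreover have "hermite_h k t = sqrt (fact k / (2 ^ k * sqrt pi)) * ((-1) ^ k * exp (t\<^sup>2 / 2) * D / fact k)"
  proof -
    have "exp (t\<^sup>2) * exp (- t\<^sup>2 / 2) = exp (t\<^sup>2 / 2)" by (simp flip: exp_add)
    moreover have "sqrt (fact k / (2 ^ k * sqrt pi)) = fact k / sqrt (2 ^ k * fact k * sqrt pi)"
    proof -
      have "sqrt (fact k / (2 ^ k * sqrt pi)) = sqrt ((fact k)\<^sup>2 / (2 ^ k * fact k * sqrt pi))"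
        by (simp add: power2_eq_square)
      then show ?thesis by (simp add: real_sqrt_divide)
    qed
    ultimately show ?thesis
      unfolding hermite_h_def hermite_H_def D_def [symmetric] by (simp add: mult_ac)
  qed
  ultimately show ?thesis by simp
qed

section \<open>Pointwise bound for the Hermite functions\<close>

lemma (in prob_space) norm_integral_le_const:
  fixes g :: "'a \<Rightarrow> 'b::{banach, second_countable_topology}"
  assumes "\<And>x. x \<in> space M \<Longrightarrow> norm (g x) \<le> B"
  shows "norm (integral\<^sup>L M g) \<le> B"
proof -
  obtain x where "x \<in> space M" using not_empty by blast
  then have "0 \<le> B" using assms norm_ge_zero order_trans by blast
  then have "(LINT x|M. norm (g x)) \<le> (LINT x|M. B)"
    using assms by (intro integral_mono') auto
  then show ?thesis
    by (intro order_trans[OF integral_norm_bound]) (simp add: prob_space)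
qed

text \<open>Cauchy's estimate with \<open>b = 1\<close>, where the Gaussian decay of the kernel in
  \<open>t\<close> is traded for the factor \<open>1 / (1 + t\<^sup>2)\<close>. The result is an
  integrable majorant of the square that grows only polynomially in \<open>k\<close>; it takes the
  place of the exact norm.\<close>

lemma hermite_h_square_le: "(hermite_h k t)\<^sup>2 \<le> 18 * (real k + 1)\<^sup>2 / (1 + t\<^sup>2)"
proof -
  interpret prob_space unit_interval by (rule prob_space_unit_interval)
  obtain \<rho> where \<rho>: "\<rho> > 0" "\<rho>\<^sup>2 = (real k + 1) / (2 * 1)"
    and b: "sqrt (fact k / 2 ^ k) / \<rho> ^ k * exp (1 * \<rho>\<^sup>2) \<le> sqrt (exp 1 * (real k + 1)) * sqrt 1 ^ k"
    using hermite_radius[of 1 k] by auto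
  \<comment> \<open>\<open>S\<close> dominates \<open>exp (- u\<^sup>2 / 2)\<close> for
    \<open>u = 2 * Re z + t\<close> on the whole circle of radius \<open>\<rho>\<close>. It comes
    from \<open>t\<^sup>2 \<le> 2 * (u\<^sup>2 + 4 * (Re z)\<^sup>2)\<close> and
    \<open>1 + u\<^sup>2 \<le> exp (u\<^sup>2)\<close>.\<close>
  define S where "S = sqrt (2 * (1 + 4 * \<rho>\<^sup>2) / (1 + t\<^sup>2))"
  have t: "1 + t\<^sup>2 > 0" by (simp add: add_pos_nonneg)
  have kernel: "cmod (hermite_kernel z t) \<le> exp (\<rho>\<^sup>2) * S" if z: "cmod z = \<rho>" for z
  proof -
    define u where "u = 2 * Re z + t"
    have "(Re z)\<^sup>2 \<le> \<rho>\<^sup>2" unfolding z [symmetric] cmod_power2 by simp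
    have "t\<^sup>2 \<le> 2 * (u\<^sup>2 + 4 * (Re z)\<^sup>2)"
      using zero_le_power2[of "u + 2 * Re z"] by (simp add: u_def power2_eq_square algebra_simps)
    then have "1 + t\<^sup>2 \<le> 2 * (1 + 4 * (Re z)\<^sup>2) * (1 + u\<^sup>2)"
      by (simp add: algebra_simps) (smt (verit) mult_nonneg_nonneg zero_le_power2)
    also have "\<dots> \<le> 2 * (1 + 4 * \<rho>\<^sup>2) * (1 + u\<^sup>2)"
      using \<open>(Re z)\<^sup>2 \<le> \<rho>\<^sup>2\<close> by (intro mult_right_mono) auto
    also have "\<dots> \<le> 2 * (1 + 4 * \<rho>\<^sup>2) * exp (u\<^sup>2)"
      by (intro mult_left_mono exp_ge_add_one_self) auto
    finally have "exp (- u\<^sup>2) \<le> 2 * (1 + 4 * \<rho>\<^sup>2) / (1 + t\<^sup>2)"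
      using t by (simp add: exp_minus field_simps)
    moreover have "exp (- u\<^sup>2) = (exp (- u\<^sup>2 / 2))\<^sup>2" by (simp add: exp_double [symmetric])
    ultimately have "exp (- u\<^sup>2 / 2) \<le> S" unfolding S_def by (intro real_le_rsqrt) simp
    then show ?thesis
      unfolding cmod_hermite_kernel_square z u_def diff_conv_add_uminus exp_add by simp
  qed
  have "\<bar>hermite_h k t\<bar> = cmod (complex_of_real (hermite_h k t))" by simp
  also have "\<dots> = sqrt (fact k / (2 ^ k * sqrt pi)) *
     cmod (LINT \<theta>|unit_interval. hermite_kernel (circle_point \<rho> \<theta>) t * (1 / (- circle_point \<rho> \<theta>) ^ k))"
    by (subst hermite_h_eq_circle_mean[OF \<rho>(1)]) (simp add: norm_mult)
  also have "\<dots> \<le> sqrt (fact k / 2 ^ k) * (exp (\<rho>\<^sup>2) * S * (1 / \<rho> ^ k))"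
  proof (intro mult_mono norm_integral_le_const)
    show "sqrt (fact k / (2 ^ k * sqrt pi)) \<le> sqrt (fact k / 2 ^ k)"
      using pi_gt3 by (intro real_sqrt_le_mono divide_left_mono) auto
    fix \<theta>
    show "cmod (hermite_kernel (circle_point \<rho> \<theta>) t * (1 / (- circle_point \<rho> \<theta>) ^ k)) \<le> exp (\<rho>\<^sup>2) * S * (1 / \<rho> ^ k)"
      unfolding norm_mult using \<rho> kernel[of "circle_point \<rho> \<theta>"]
      by (intro mult_mono) (auto simp: norm_divide norm_power cmod_circle_point S_def)
  qed (use \<rho> in \<open>auto simp: S_def\<close>)
  also have "\<dots> = (sqrt (fact k / 2 ^ k) / \<rho> ^ k * exp (1 * \<rho>\<^sup>2)) * S" by simp
  also have "\<dots> \<le> sqrt (exp 1 * (real k + 1)) * S"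
    using b by (intro mult_right_mono) (auto simp: S_def)
  finally have "(hermite_h k t)\<^sup>2 \<le> (sqrt (exp 1 * (real k + 1)) * S)\<^sup>2"
    using abs_le_square_iff by fastforce
  also have "\<dots> = exp 1 * (real k + 1) * (2 * (1 + 4 * \<rho>\<^sup>2) / (1 + t\<^sup>2))"
    using t by (simp add: power_mult_distrib S_def)
  \<comment> \<open>Here \<open>4 * \<rho>\<^sup>2 = 2 * (k + 1)\<close>, so
    \<open>2 * (1 + 4 * \<rho>\<^sup>2) = 4 * k + 6 \<le> 6 * (k + 1)\<close>.\<close>
  also have "\<dots> \<le> 3 * (real k + 1) * (6 * (real k + 1) / (1 + t\<^sup>2))"
  proof (rule mult_mono)
    show "2 * (1 + 4 * \<rho>\<^sup>2) / (1 + t\<^sup>2) \<le> 6 * (real k + 1) / (1 + t\<^sup>2)"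
      using t unfolding \<rho> by (intro divide_right_mono) (auto simp: field_simps)
    show "exp 1 * (real k + 1) \<le> 3 * (real k + 1)"
      by (intro mult_right_mono exp_le) auto
  qed (use t in auto)
  also have "\<dots> = 18 * (real k + 1)\<^sup>2 / (1 + t\<^sup>2)" by (simp add: power2_eq_square algebra_simps)
  finally show ?thesis .
qed

section \<open>Growth of the Hermite transform and its invariance under the Fourier
  transform\<close>

lemma has_bochner_integral_gaussian_real:
  fixes b c :: real
  assumes "c > 0"
  shows "has_bochner_integral lborel (\<lambda>x. exp (- (c * x\<^sup>2 / 2) + b * x))
           (sqrt (2 * pi / c) * exp (b\<^sup>2 / (2 * c)))"
proof -
  have "exp (- complex_of_real (c * x\<^sup>2 / 2) + of_real b * of_real x) = of_real (exp (- (c * x\<^sup>2 / 2) + b * x))"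
    for x by (simp add: exp_of_real [symmetric])
  moreover have "exp ((of_real b)\<^sup>2 / of_real (2 * c)) = complex_of_real (exp (b\<^sup>2 / (2 * c)))"
    by (simp add: exp_of_real [symmetric])
  ultimately have "has_bochner_integral lborel (\<lambda>x. complex_of_real (exp (- (c * x\<^sup>2 / 2) + b * x)))
      (complex_of_real (sqrt (2 * pi / c) * exp (b\<^sup>2 / (2 * c))))"
    using has_bochner_integral_gaussian[OF assms, of "of_real b"] by simp
  from has_bochner_integral_bounded_linear[OF bounded_linear_Re this] show ?thesis by simp
qed

text \<open>Explicit integrals are computed for \<open>lborel\<close>; this carries them over to its
  completion, the measure of the theorem.\<close>

lemma integral_lebesgue_eq:
  fixes g :: "'a::euclidean_space \<Rightarrow> 'b::{banach, second_countable_topology}"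
  assumes "has_bochner_integral lborel g I"
  shows "integrable lebesgue g" "integral\<^sup>L lebesgue g = I"
proof -
  have "g \<in> borel_measurable lborel" using assms by (auto simp: has_bochner_integral_iff)
  from integrable_completion[OF this] integral_completion[OF this] assms
  show "integrable lebesgue g" "integral\<^sup>L lebesgue g = I" by (simp_all add: has_bochner_integral_iff)
qed

definition hermite_transform :: "(real ^ 'n::finite \<Rightarrow> complex) \<Rightarrow> ('n \<Rightarrow> complex) \<Rightarrow> complex" where
  "hermite_transform f z = (LINT x|lebesgue. f x * (\<Prod>j\<in>UNIV. hermite_kernel (z j) (x $ j)))"

text \<open>The modulus of the integrand is dominated by a product of Gaussians in one variable.
  Their quadratic coefficient \<open>(1 + a) / 2\<close> adds \<open>a / 2\<close> from the bound on
  \<open>f\<close> to \<open>1 / 2\<close> from the kernel, and the linear coefficient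
  \<open>- 2 * Re (z j)\<close> produces the exponent
  \<open>2 * (Re (z j))\<^sup>2 / (1 + a)\<close>.\<close>

lemma cmod_hermite_transform_le:
  fixes f :: "real ^ 'n::finite \<Rightarrow> complex"
  assumes a: "a > 0" and f: "\<And>x. cmod (f x) \<le> C * exp (- (1/2) * a * (norm x)\<^sup>2)"
  shows "cmod (hermite_transform f z) \<le> C * sqrt (2 * pi / (1 + a)) ^ CARD('n) *
    exp (\<Sum>j\<in>UNIV. 2 * (Re (z j))\<^sup>2 / (1 + a) - (Re (z j))\<^sup>2 + (Im (z j))\<^sup>2)"
proof -
  define g where "g = (\<lambda>j t. exp (- (Re (z j))\<^sup>2 + (Im (z j))\<^sup>2) * exp (- ((1 + a) * t\<^sup>2 / 2) + (- 2 * Re (z j)) * t))"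
  define I where "I = (\<lambda>j. exp (- (Re (z j))\<^sup>2 + (Im (z j))\<^sup>2) *
      (sqrt (2 * pi / (1 + a)) * exp ((- 2 * Re (z j))\<^sup>2 / (2 * (1 + a)))))"
  have C: "C \<ge> 0" using f[of 0] by (simp add: order_trans[OF norm_ge_zero])
  have "has_bochner_integral lborel (\<lambda>x::real^'n. C * (\<Prod>j\<in>UNIV. g j (x $ j))) (C * (\<Prod>j\<in>UNIV. I j))"
    unfolding g_def I_def using a
    by (intro has_bochner_integral_mult_right has_bochner_integral_lborel_prod_vec
        has_bochner_integral_gaussian_real) auto
  note int = integral_lebesgue_eq[OF this]
  have le: "cmod (f x * (\<Prod>j\<in>UNIV. hermite_kernel (z j) (x $ j))) \<le> C * (\<Prod>j\<in>UNIV. g j (x $ j))" for x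
  proof -
    have "(norm x)\<^sup>2 = (\<Sum>j\<in>UNIV. (x $ j)\<^sup>2)"
      by (simp add: norm_vec_def L2_set_def sum_nonneg)
    then have split: "C * exp (- (1/2) * a * (norm x)\<^sup>2) * (\<Prod>j\<in>UNIV. cmod (hermite_kernel (z j) (x $ j))) =
        C * (\<Prod>j\<in>UNIV. exp (- (1/2) * a * (x $ j)\<^sup>2) * cmod (hermite_kernel (z j) (x $ j)))"
      by (simp add: sum_distrib_left sum_negf [symmetric] exp_sum prod.distrib del: exp_minus)
    have "cmod (f x * (\<Prod>j\<in>UNIV. hermite_kernel (z j) (x $ j))) =
        cmod (f x) * (\<Prod>j\<in>UNIV. cmod (hermite_kernel (z j) (x $ j)))"
      by (simp add: norm_mult prod_norm)
    also have "\<dots> \<le> C * exp (- (1/2) * a * (norm x)\<^sup>2) * (\<Prod>j\<in>UNIV. cmod (hermite_kernel (z j) (x $ j)))"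
      by (intro mult_right_mono f prod_nonneg) auto
    also note split
    also have "(\<lambda>j. exp (- (1/2) * a * (x $ j)\<^sup>2) * cmod (hermite_kernel (z j) (x $ j))) = (\<lambda>j. g j (x $ j))"
      by (rule ext) (simp add: g_def cmod_hermite_kernel field_simps flip: exp_add)
    finally show ?thesis .
  qed
  have "cmod (hermite_transform f z) \<le> (LINT x|lebesgue. cmod (f x * (\<Prod>j\<in>UNIV. hermite_kernel (z j) (x $ j))))"
    unfolding hermite_transform_def by (rule integral_norm_bound)
  also have "\<dots> \<le> (LINT x|lebesgue. C * (\<Prod>j\<in>UNIV. g j ((x::real^'n) $ j)))"
    using C by (intro integral_mono' int le) (auto simp: g_def intro!: mult_nonneg_nonneg prod_nonneg)
  also have "\<dots> = C * (\<Prod>j\<in>UNIV. I j)" by (rule int)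
  also have "(\<Prod>j\<in>UNIV. I j) = sqrt (2 * pi / (1 + a)) ^ CARD('n) *
    exp (\<Sum>j\<in>UNIV. 2 * (Re (z j))\<^sup>2 / (1 + a) - (Re (z j))\<^sup>2 + (Im (z j))\<^sup>2)"
  proof -
    have "I j = sqrt (2 * pi / (1 + a)) * exp (2 * (Re (z j))\<^sup>2 / (1 + a) - (Re (z j))\<^sup>2 + (Im (z j))\<^sup>2)" for j
    proof -
      have "(- 2 * Re (z j))\<^sup>2 / (2 * (1 + a)) = 2 * (Re (z j))\<^sup>2 / (1 + a)"
        using a by (simp add: power_mult_distrib divide_simps)
      then show ?thesis unfolding I_def by (simp add: mult_exp_exp algebra_simps)
    qed
    then show ?thesis by (simp add: prod.distrib exp_sum)
  qed
  finally show ?thesis by (simp add: mult_ac)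
qed

text \<open>The integrand is a Gaussian with linear coefficient
  \<open>- 2 * \<i> * z - \<i> * x\<close>, whose square is \<open>- (2 * z + x)\<^sup>2\<close>;
  together with the factor \<open>exp (z\<^sup>2)\<close> this gives back the exponent of the kernel
  at \<open>z\<close>.\<close>

lemma has_bochner_integral_fourier_hermite_kernel:
  "has_bochner_integral lborel (\<lambda>y. exp (- \<i> * of_real (x * y)) * hermite_kernel (\<i> * z) y)
     (of_real (sqrt (2 * pi)) * hermite_kernel z x)"
proof -
  have eq: "exp (z\<^sup>2) * exp (- complex_of_real (1 * y\<^sup>2 / 2) + (- 2 * \<i> * z - \<i> * x) * of_real y) =
      exp (- \<i> * of_real (x * y)) * hermite_kernel (\<i> * z) y" for y
    unfolding hermite_kernel_def exp_add [symmetric]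
    by (rule arg_cong[where f=exp]) (simp add: power_mult_distrib algebra_simps)
  have K: "hermite_kernel z x = exp (z\<^sup>2) * exp ((- 2 * \<i> * z - \<i> * x)\<^sup>2 / of_real (2 * 1))"
  proof -
    have "(- 2 * \<i> * z - \<i> * x)\<^sup>2 = - (2 * z + x)\<^sup>2"
      by (simp add: power2_eq_square algebra_simps)
    then show ?thesis
      unfolding hermite_kernel_def exp_add [symmetric]
      by (intro arg_cong[where f=exp]) (simp add: power2_eq_square field_simps)
  qed
  have val: "exp (z\<^sup>2) * (complex_of_real (sqrt (2 * pi / 1)) * exp ((- 2 * \<i> * z - \<i> * x)\<^sup>2 / of_real (2 * 1))) =
     of_real (sqrt (2 * pi)) * hermite_kernel z x"
    unfolding K div_by_1 by (rule mult.left_commute)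
  show ?thesis
    using has_bochner_integral_mult_right[OF has_bochner_integral_gaussian[of 1 "- 2 * \<i> * z - \<i> * x"], of "exp (z\<^sup>2)"]
    unfolding eq val by simp
qed

lemma borel_measurable_vec_nth_lebesgue [measurable]: "(\<lambda>x::real^'n::finite. x $ j) \<in> borel_measurable lebesgue"
  by (intro measurable_completion) simp

text \<open>On the side of the Hermite functions this says that \<open>h\<^sub>k\<close> is an eigenfunction of the Fourier transform
  with eigenvalue \<open>(- \<i>)\<^sup>k\<close>.\<close>

lemma hermite_transform_fourier:
  fixes f :: "real ^ 'n::finite \<Rightarrow> complex"
  assumes f: "integrable lebesgue f"
  shows "hermite_transform (fourier f) (\<lambda>j. \<i> * z j) = hermite_transform f z"
proof -
  define c where "c = complex_of_real ((2 * pi) powr (- real CARD('n) / 2))"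
  define k where "k = (\<lambda>(x::real^'n) (y::real^'n). exp (- \<i> * complex_of_real (x \<bullet> y)))"
  define g where "g = (\<lambda>y::real^'n. \<Prod>j\<in>UNIV. hermite_kernel (\<i> * z j) (y $ j))"
  have ker: "has_bochner_integral lborel (\<lambda>y. k x y * g y) (\<Prod>j\<in>UNIV. of_real (sqrt (2 * pi)) * hermite_kernel (z j) (x $ j))" for x
  proof -
    have "(\<lambda>y. k x y * g y) = (\<lambda>y. \<Prod>j\<in>UNIV. exp (- \<i> * of_real (x $ j * y $ j)) * hermite_kernel (\<i> * z j) (y $ j))"
    proof
      fix y
      have "- \<i> * complex_of_real (x \<bullet> y) = (\<Sum>j\<in>UNIV. - \<i> * of_real (x $ j * y $ j))"
        by (simp add: inner_vec_def sum_distrib_left)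
      then show "k x y * g y = (\<Prod>j\<in>UNIV. exp (- \<i> * of_real (x $ j * y $ j)) * hermite_kernel (\<i> * z j) (y $ j))"
        unfolding k_def g_def prod.distrib by (simp only: exp_sum[OF finite])
    qed
    then show ?thesis
      using has_bochner_integral_lborel_prod_vec[OF has_bochner_integral_fourier_hermite_kernel, of "\<lambda>j. x $ j" z] by simp
  qed
  have g: "integrable lebesgue g"
    using ker[of 0] by (intro integral_lebesgue_eq) (auto simp: k_def)
  have c: "c * (\<Prod>j\<in>(UNIV::'n set). of_real (sqrt (2 * pi))) = 1"
  proof -
    have "sqrt (2 * pi) ^ CARD('n) = (2 * pi) powr (real CARD('n) / 2)"
      by (simp add: powr_half_sqrt [symmetric] powr_realpow [symmetric] powr_powr)
    then have "(2 * pi) powr (- real CARD('n) / 2) * sqrt (2 * pi) ^ CARD('n) = 1"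
      by (simp flip: powr_add)
    then show ?thesis unfolding c_def by (simp flip: of_real_power of_real_mult)
  qed
  have meas: "(\<lambda>(x, y). k x y) \<in> borel_measurable (lebesgue \<Otimes>\<^sub>M lebesgue)"
  proof -
    have id: "(\<lambda>x::real^'n. x) \<in> borel_measurable lebesgue" by (intro measurable_completion) simp
    have [measurable]: "fst \<in> borel_measurable ((lebesgue :: (real^'n) measure) \<Otimes>\<^sub>M (lebesgue :: (real^'n) measure))"
      by (rule measurable_compose[OF measurable_fst id])
    have [measurable]: "snd \<in> borel_measurable ((lebesgue :: (real^'n) measure) \<Otimes>\<^sub>M (lebesgue :: (real^'n) measure))"
      by (rule measurable_compose[OF measurable_snd id])
    have [measurable]: "(exp :: complex \<Rightarrow> complex) \<in> borel_measurable borel"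
      by (intro borel_measurable_continuous_onI continuous_intros)
    show ?thesis unfolding k_def case_prod_beta by measurable
  qed
  have "hermite_transform (fourier f) (\<lambda>j. \<i> * z j) = c * (LINT y|lebesgue. (LINT x|lebesgue. f x * k x y) * g y)"
    unfolding hermite_transform_def fourier_def c_def [symmetric] k_def g_def
    by (simp add: mult.assoc)
  \<comment> \<open>The Fourier transform moves from \<open>f\<close> onto the Gaussian
    \<open>g\<close>; the bound 1 is the modulus of the Fourier kernel.\<close>
  also have "\<dots> = c * (LINT x|lebesgue. f x * (LINT y|lebesgue. k x y * g y))"
    by (subst integral_bounded_kernel_swap[OF sigma_finite_measure_lebesgue sigma_finite_measure_lebesgue f g meas, of 1])
       (auto simp: k_def)
  also have "\<dots> = (c * (\<Prod>j\<in>(UNIV::'n set). of_real (sqrt (2 * pi)))) * hermite_transform f z"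
  proof -
    have "f x * (LINT y|lebesgue. k x y * g y) =
        (\<Prod>j\<in>(UNIV::'n set). of_real (sqrt (2 * pi))) * (f x * (\<Prod>j\<in>UNIV. hermite_kernel (z j) (x $ j)))" for x
      unfolding integral_lebesgue_eq(2)[OF ker] prod.distrib by (simp only: mult.left_commute)
    then show ?thesis
      unfolding hermite_transform_def by (simp only: integral_mult_right_zero mult.assoc)
  qed
  finally show ?thesis by (simp only: c mult_1)
qed

lemma cmod_hermite_transform_le_geometric_mean:
  fixes f :: "real ^ 'n::finite \<Rightarrow> complex"
  assumes f: "integrable lebesgue f" and a: "a > 0"
    and "\<And>x. cmod (f x) \<le> C * exp (- (1/2) * a * (norm x)\<^sup>2)"
    and "\<And>x. cmod (fourier f x) \<le> C * exp (- (1/2) * a * (norm x)\<^sup>2)"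
  shows "cmod (hermite_transform f z) \<le> C * sqrt (2 * pi / (1 + a)) ^ CARD('n) *
    exp (1 / (1 + a) * (\<Sum>j\<in>UNIV. (cmod (z j))\<^sup>2))"
proof -
  define K where "K = C * sqrt (2 * pi / (1 + a)) ^ CARD('n)"
  have "C \<ge> 0" using assms(3)[of 0] by (simp add: order_trans[OF norm_ge_zero])
  then have K: "K \<ge> 0" using a by (simp add: K_def)
  define A where "A = (\<Sum>j\<in>UNIV. 2 * (Re (z j))\<^sup>2 / (1 + a) - (Re (z j))\<^sup>2 + (Im (z j))\<^sup>2)"
  define B where "B = (\<Sum>j\<in>UNIV. 2 * (Im (z j))\<^sup>2 / (1 + a) - (Im (z j))\<^sup>2 + (Re (z j))\<^sup>2)"
  have "cmod (hermite_transform f z) \<le> K * exp A"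
    using cmod_hermite_transform_le[OF a assms(3)] by (simp add: K_def A_def)
  \<comment> \<open>Multiplication by \<open>\<i>\<close> interchanges real and imaginary parts up
    to a sign, which the squares remove.\<close>
  moreover have "cmod (hermite_transform f z) \<le> K * exp B"
    using cmod_hermite_transform_le[OF a assms(4), of "\<lambda>j. \<i> * z j"]
    by (simp add: K_def B_def hermite_transform_fourier[OF f])
  ultimately have "(cmod (hermite_transform f z))\<^sup>2 \<le> (K * exp A) * (K * exp B)"
    unfolding power2_eq_square using K by (intro mult_mono) auto
  also have "\<dots> = (K * exp (1 / (1 + a) * (\<Sum>j\<in>UNIV. (cmod (z j))\<^sup>2)))\<^sup>2"
  proof -
    \<comment> \<open>The terms without the factor \<open>2 / (1 + a)\<close> cancel between
      \<open>A\<close> and \<open>B\<close>.\<close>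
    have "A + B = 2 * (1 / (1 + a) * (\<Sum>j\<in>UNIV. (cmod (z j))\<^sup>2))"
      unfolding A_def B_def sum.distrib [symmetric] sum_distrib_left cmod_power2
      by (intro sum.cong) (auto simp: add_divide_distrib)
    then have "exp A * exp B = (exp (1 / (1 + a) * (\<Sum>j\<in>UNIV. (cmod (z j))\<^sup>2)))\<^sup>2"
      by (simp only: exp_add [symmetric] exp_double)
    then show ?thesis by (simp add: power_mult_distrib power2_eq_square)
  qed
  finally have "cmod (hermite_transform f z) \<le> K * exp (1 / (1 + a) * (\<Sum>j\<in>UNIV. (cmod (z j))\<^sup>2))"
    by (rule power2_le_imp_le) (use K in auto)
  then show ?thesis by (simp only: K_def)
qed

section \<open>Cauchy's estimates for the Hermite coefficients\<close>

text \<open>A product of circle means is a mean over the torus, which is then exchanged with the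
  integral against \<open>f\<close>. This is Cauchy's coefficient formula on a polydisc, obtained
  from the kernel alone, without a theory of holomorphic functions of several variables.\<close>

lemma L2_inner_hermite_fun_eq_torus_mean:
  fixes f :: "real ^ 'n::finite \<Rightarrow> complex"
  assumes f: "integrable lebesgue f" and \<rho>: "\<And>j. \<rho> j > 0"
  shows "L2_inner f (\<lambda>y. complex_of_real (hermite_fun \<alpha> y)) =
    (\<Prod>j\<in>UNIV. of_real (sqrt (fact (\<alpha> j) / (2 ^ \<alpha> j * sqrt pi)))) *
    (LINT \<theta>|(\<Pi>\<^sub>M j\<in>UNIV. unit_interval). hermite_transform f (\<lambda>j. circle_point (\<rho> j) (\<theta> j)) *
       (\<Prod>j\<in>UNIV. 1 / (- circle_point (\<rho> j) (\<theta> j)) ^ \<alpha> j))"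
proof -
  interpret unit: prob_space unit_interval by (rule prob_space_unit_interval)
  interpret torus: product_prob_space "\<lambda>_::'n. unit_interval" ..
  interpret T: prob_space "\<Pi>\<^sub>M j\<in>(UNIV::'n set). unit_interval"
    by (rule prob_space_PiM) (rule prob_space_unit_interval)
  define k where "k = (\<lambda>(x::real^'n) \<theta>. \<Prod>j\<in>UNIV. hermite_kernel (circle_point (\<rho> j) (\<theta> j)) (x $ j))"
  define g where "g = (\<lambda>\<theta>. \<Prod>j\<in>UNIV. 1 / (- circle_point (\<rho> j) (\<theta> j)) ^ \<alpha> j)"
  define c where "c = (\<Prod>j\<in>UNIV. complex_of_real (sqrt (fact (\<alpha> j) / (2 ^ \<alpha> j * sqrt pi))))"
  have [measurable]: "(\<lambda>\<theta>. circle_point (\<rho> j) (\<theta> j)) \<in> borel_measurable (\<Pi>\<^sub>M j\<in>UNIV. unit_interval)" for j :: 'n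
    by (rule measurable_compose[OF measurable_component_singleton]) (auto intro: borel_measurable_unit_interval)
  have circ: "cmod (circle_point (\<rho> j) t) = \<rho> j" for j t
    using \<rho>[of j] by (simp add: cmod_circle_point)
  have g: "integrable (\<Pi>\<^sub>M j\<in>UNIV. unit_interval) g"
  proof (rule T.integrable_const_bound[of _ "\<Prod>j\<in>UNIV. 1 / \<rho> j ^ \<alpha> j"])
    show "AE \<theta> in \<Pi>\<^sub>M j\<in>UNIV. unit_interval. norm (g \<theta>) \<le> (\<Prod>j\<in>UNIV. 1 / \<rho> j ^ \<alpha> j)"
      by (simp add: g_def norm_divide norm_power circ flip: prod_norm)
    show "g \<in> borel_measurable (\<Pi>\<^sub>M j\<in>UNIV. unit_interval)"
      unfolding g_def by measurable
  qed
  have factor: "integrable unit_interval (\<lambda>\<theta>. hermite_kernel (circle_point (\<rho> j) \<theta>) t * (1 / (- circle_point (\<rho> j) \<theta>) ^ \<alpha> j))" for j t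
  proof (rule unit.integrable_const_bound[of _ "exp ((\<rho> j)\<^sup>2) * (1 / \<rho> j ^ \<alpha> j)"])
    show "AE \<theta> in unit_interval. norm (hermite_kernel (circle_point (\<rho> j) \<theta>) t * (1 / (- circle_point (\<rho> j) \<theta>) ^ \<alpha> j))
        \<le> exp ((\<rho> j)\<^sup>2) * (1 / \<rho> j ^ \<alpha> j)"
      unfolding norm_mult using \<rho>[of j] cmod_hermite_kernel_le[of "circle_point (\<rho> j) _" t]
      by (intro AE_I2 mult_mono) (auto simp: norm_divide norm_power circ)
    show "(\<lambda>\<theta>. hermite_kernel (circle_point (\<rho> j) \<theta>) t * (1 / (- circle_point (\<rho> j) \<theta>) ^ \<alpha> j)) \<in> borel_measurable unit_interval"
      by (rule borel_measurable_unit_interval) measurable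
  qed
  have expand: "complex_of_real (hermite_fun \<alpha> x) = c * (LINT \<theta>|(\<Pi>\<^sub>M j\<in>UNIV. unit_interval). k x \<theta> * g \<theta>)" for x
  proof -
    have "complex_of_real (hermite_fun \<alpha> x) = c *
        (\<Prod>j\<in>UNIV. LINT t|unit_interval. hermite_kernel (circle_point (\<rho> j) t) (x $ j) * (1 / (- circle_point (\<rho> j) t) ^ \<alpha> j))"
      unfolding hermite_fun_def of_real_prod c_def prod.distrib [symmetric]
      by (intro prod.cong refl hermite_h_eq_circle_mean \<rho>)
    also have "(\<Prod>j\<in>UNIV. LINT t|unit_interval. hermite_kernel (circle_point (\<rho> j) t) (x $ j) * (1 / (- circle_point (\<rho> j) t) ^ \<alpha> j)) =
       (LINT \<theta>|(\<Pi>\<^sub>M j\<in>UNIV. unit_interval). (\<Prod>j\<in>UNIV. hermite_kernel (circle_point (\<rho> j) (\<theta> j)) (x $ j) * (1 / (- circle_point (\<rho> j) (\<theta> j)) ^ \<alpha> j)))"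
      by (rule torus.product_integral_prod [symmetric]) (rule finite, rule factor)
    finally show ?thesis unfolding k_def g_def prod.distrib .
  qed
  have meas: "(\<lambda>(x, \<theta>). k x \<theta>) \<in> borel_measurable (lebesgue \<Otimes>\<^sub>M (\<Pi>\<^sub>M j\<in>UNIV. unit_interval))"
  proof -
    have [measurable]: "(\<lambda>p. fst p $ j) \<in> borel_measurable ((lebesgue :: (real^'n) measure) \<Otimes>\<^sub>M (\<Pi>\<^sub>M j\<in>(UNIV::'n set). unit_interval))" for j :: 'n
      by (rule measurable_compose[OF measurable_fst borel_measurable_vec_nth_lebesgue])
    have [measurable]: "(\<lambda>p. circle_point (\<rho> j) (snd p j)) \<in> borel_measurable ((lebesgue :: (real^'n) measure) \<Otimes>\<^sub>M (\<Pi>\<^sub>M j\<in>UNIV. unit_interval))" for j :: 'n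
      by (rule measurable_compose[OF measurable_snd]) measurable
    show ?thesis unfolding k_def case_prod_beta by measurable
  qed
  have bound: "cmod (k x \<theta>) \<le> (\<Prod>j\<in>UNIV. exp ((\<rho> j)\<^sup>2))" for x \<theta>
    unfolding k_def prod_norm [symmetric]
    using cmod_hermite_kernel_le[of "circle_point (\<rho> _) _"] by (intro prod_mono) (simp add: circ)
  have "L2_inner f (\<lambda>y. complex_of_real (hermite_fun \<alpha> y)) =
      (LINT x|lebesgue. c * (f x * (LINT \<theta>|(\<Pi>\<^sub>M j\<in>UNIV. unit_interval). k x \<theta> * g \<theta>)))"
    unfolding L2_inner_def complex_cnj_complex_of_real
    unfolding expand by (simp only: mult.left_commute)
  also have "\<dots> = c * (LINT x|lebesgue. f x * (LINT \<theta>|(\<Pi>\<^sub>M j\<in>UNIV. unit_interval). k x \<theta> * g \<theta>))"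
    by (rule integral_mult_right_zero)
  also have "\<dots> = c * (LINT \<theta>|(\<Pi>\<^sub>M j\<in>UNIV. unit_interval). (LINT x|lebesgue. f x * k x \<theta>) * g \<theta>)"
    by (subst integral_bounded_kernel_swap[OF sigma_finite_measure_lebesgue T.sigma_finite_measure f g meas bound]) rule
  finally show ?thesis unfolding c_def k_def g_def hermite_transform_def .
qed

text \<open>The growth bound and the normalisation both factor over the coordinates, so the radius
  can be chosen for each \<open>\<alpha> j\<close> separately. The powers of \<open>sqrt b\<close>
  multiply to \<open>sqrt b ^ k\<close> because the entries of \<open>\<alpha>\<close> sum to
  \<open>k\<close>, and each remaining factor is at most \<open>3 * (k + 1)\<close>.\<close>

lemma cmod_L2_inner_hermite_fun_le:
  fixes f :: "real ^ 'n::finite \<Rightarrow> complex"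
  assumes f: "integrable lebesgue f" and b: "b > 0" and K: "K \<ge> 0"
    and bound: "\<And>z. cmod (hermite_transform f z) \<le> K * exp (b * (\<Sum>j\<in>UNIV. (cmod (z j))\<^sup>2))"
    and \<alpha>: "\<alpha> \<in> multi_indices k"
  shows "cmod (L2_inner f (\<lambda>y. complex_of_real (hermite_fun \<alpha> y))) \<le> K * (3 * (real k + 1)) ^ CARD('n) * sqrt b ^ k"
proof -
  interpret T: prob_space "\<Pi>\<^sub>M j\<in>(UNIV::'n set). unit_interval"
    by (rule prob_space_PiM) (rule prob_space_unit_interval)
  have sum: "(\<Sum>j\<in>UNIV. \<alpha> j) = k" using \<alpha> by (simp add: multi_indices_def)
  then have le: "\<alpha> j \<le> k" for j using member_le_sum[of j UNIV \<alpha>] by auto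
  have "\<exists>\<rho>>0. sqrt (fact (\<alpha> j) / 2 ^ \<alpha> j) / \<rho> ^ \<alpha> j * exp (b * \<rho>\<^sup>2) \<le> sqrt (exp 1 * (real (\<alpha> j) + 1)) * sqrt b ^ \<alpha> j" for j
    by (rule hermite_radius[OF b, of "\<alpha> j"]) blast
  then obtain \<rho> where \<rho>: "\<And>j. \<rho> j > 0" and opt:
    "\<And>j. sqrt (fact (\<alpha> j) / 2 ^ \<alpha> j) / \<rho> j ^ \<alpha> j * exp (b * (\<rho> j)\<^sup>2) \<le> sqrt (exp 1 * (real (\<alpha> j) + 1)) * sqrt b ^ \<alpha> j"
    by metis
  have circ: "cmod (circle_point (\<rho> j) t) = \<rho> j" for j t
    using \<rho>[of j] by (simp add: cmod_circle_point)
  have "cmod (L2_inner f (\<lambda>y. complex_of_real (hermite_fun \<alpha> y))) =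
    (\<Prod>j\<in>UNIV. sqrt (fact (\<alpha> j) / (2 ^ \<alpha> j * sqrt pi))) *
    cmod (LINT \<theta>|(\<Pi>\<^sub>M j\<in>UNIV. unit_interval). hermite_transform f (\<lambda>j. circle_point (\<rho> j) (\<theta> j)) *
       (\<Prod>j\<in>UNIV. 1 / (- circle_point (\<rho> j) (\<theta> j)) ^ \<alpha> j))"
    by (subst L2_inner_hermite_fun_eq_torus_mean[where \<rho>=\<rho>, OF f \<rho>]) (simp add: norm_mult flip: prod_norm)
  also have "\<dots> \<le> (\<Prod>j\<in>UNIV. sqrt (fact (\<alpha> j) / 2 ^ \<alpha> j)) *
      (K * exp (b * (\<Sum>j\<in>UNIV. (\<rho> j)\<^sup>2)) * (\<Prod>j\<in>UNIV. 1 / \<rho> j ^ \<alpha> j))"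
  proof (intro mult_mono T.norm_integral_le_const prod_mono conjI)
    fix j show "sqrt (fact (\<alpha> j) / (2 ^ \<alpha> j * sqrt pi)) \<le> sqrt (fact (\<alpha> j) / 2 ^ \<alpha> j)"
      using pi_gt3 by (intro real_sqrt_le_mono divide_left_mono) auto
  next
    fix \<theta>
    show "cmod (hermite_transform f (\<lambda>j. circle_point (\<rho> j) (\<theta> j)) * (\<Prod>j\<in>UNIV. 1 / (- circle_point (\<rho> j) (\<theta> j)) ^ \<alpha> j))
      \<le> K * exp (b * (\<Sum>j\<in>UNIV. (\<rho> j)\<^sup>2)) * (\<Prod>j\<in>UNIV. 1 / \<rho> j ^ \<alpha> j)"
      unfolding norm_mult using bound[of "\<lambda>j. circle_point (\<rho> j) (\<theta> j)"] K
      by (intro mult_mono) (auto simp: circ norm_divide norm_power less_imp_le[OF \<rho>] prod_norm [symmetric] intro!: prod_nonneg)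
  qed (auto intro!: prod_nonneg)
  also have "\<dots> = K * (\<Prod>j\<in>UNIV. sqrt (fact (\<alpha> j) / 2 ^ \<alpha> j) / \<rho> j ^ \<alpha> j * exp (b * (\<rho> j)\<^sup>2))"
    by (simp add: prod.distrib prod_dividef exp_sum sum_distrib_left)
  also have "\<dots> \<le> K * (\<Prod>j\<in>UNIV. 3 * (real k + 1) * sqrt b ^ \<alpha> j)"
  proof (intro mult_left_mono[OF _ K] prod_mono conjI)
    fix j
    show "0 \<le> sqrt (fact (\<alpha> j) / 2 ^ \<alpha> j) / \<rho> j ^ \<alpha> j * exp (b * (\<rho> j)\<^sup>2)"
      using \<rho>[of j] by simp
    have "exp 1 * (real (\<alpha> j) + 1) \<le> 3 * (real k + 1)"
      using exp_le le[of j] by (intro mult_mono) auto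
    also have "\<dots> \<le> (3 * (real k + 1))\<^sup>2" by (rule self_le_power) auto
    finally have "sqrt (exp 1 * (real (\<alpha> j) + 1)) \<le> 3 * (real k + 1)"
      by (intro real_le_lsqrt) auto
    then show "sqrt (fact (\<alpha> j) / 2 ^ \<alpha> j) / \<rho> j ^ \<alpha> j * exp (b * (\<rho> j)\<^sup>2) \<le> 3 * (real k + 1) * sqrt b ^ \<alpha> j"
      using opt[of j] b by (elim order_trans) (auto intro!: mult_right_mono)
  qed
  also have "\<dots> = K * (3 * (real k + 1)) ^ CARD('n) * sqrt b ^ k"
    by (simp add: prod.distrib sum [symmetric] power_sum)
  finally show ?thesis .
qed

section \<open>The norm of the projections\<close>

lemma card_multi_indices_le: "card (multi_indices k :: ('n::finite \<Rightarrow> nat) set) \<le> (k + 1) ^ CARD('n)"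
proof -
  have "(multi_indices k :: ('n \<Rightarrow> nat) set) \<subseteq> PiE UNIV (\<lambda>_. {..k})"
    by (auto simp: multi_indices_def PiE_def intro!: member_le_sum)
  then have "card (multi_indices k :: ('n \<Rightarrow> nat) set) \<le> card (PiE (UNIV :: 'n set) (\<lambda>_. {..k}))"
    by (intro card_mono finite_PiE) auto
  then show ?thesis by (simp add: card_PiE)
qed

lemma has_bochner_integral_inverse_1_plus_square:
  "has_bochner_integral lborel (\<lambda>t::real. 1 / (1 + t\<^sup>2)) pi"
  using integrable_inverse_1_plus_square LBINT_inverse_1_plus_square
  by (simp add: has_bochner_integral_iff set_integrable_def interval_lebesgue_integral_def
      set_lebesgue_integral_def inverse_eq_divide)

text \<open>The majorant is common to all multi-indices of order \<open>k\<close> and factors into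
  integrable functions of one variable.\<close>

lemma hermite_fun_square_le:
  fixes x :: "real ^ 'n::finite"
  assumes "\<alpha> \<in> multi_indices k"
  shows "(hermite_fun \<alpha> x)\<^sup>2 \<le> (\<Prod>j\<in>UNIV. 18 * (real k + 1)\<^sup>2 * (1 / (1 + (x $ j)\<^sup>2)))"
proof -
  have le: "\<alpha> j \<le> k" for j using assms member_le_sum[of j UNIV \<alpha>] by (auto simp: multi_indices_def)
  have "(hermite_h (\<alpha> j) (x $ j))\<^sup>2 \<le> 18 * (real k + 1)\<^sup>2 * (1 / (1 + (x $ j)\<^sup>2))" for j
  proof -
    have "18 * (real (\<alpha> j) + 1)\<^sup>2 \<le> 18 * (real k + 1)\<^sup>2"
      using le[of j] by (intro mult_left_mono power_mono) auto
    then have "18 * (real (\<alpha> j) + 1)\<^sup>2 / (1 + (x $ j)\<^sup>2) \<le> 18 * (real k + 1)\<^sup>2 / (1 + (x $ j)\<^sup>2)"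
      by (rule divide_right_mono) simp
    then show ?thesis using hermite_h_square_le[of "\<alpha> j" "x $ j"] by simp
  qed
  then show ?thesis
    unfolding hermite_fun_def prod_power_distrib by (intro prod_mono) auto
qed

text \<open>The triangle inequality, applied pointwise, stands in for orthonormality. The number of
  multi-indices contributes \<open>(k + 1) ^ n\<close>, and the square root of the integral of the
  common majorant contributes \<open>sqrt (18 * pi) ^ n * (k + 1) ^ n\<close>, with \<open>n\<close>
  the dimension.\<close>

lemma L2_norm_hermite_proj_le:
  fixes f :: "real ^ 'n::finite \<Rightarrow> complex"
  assumes M: "\<And>\<alpha>. \<alpha> \<in> multi_indices k \<Longrightarrow> cmod (L2_inner f (\<lambda>y. complex_of_real (hermite_fun \<alpha> y))) \<le> M"
    and "M \<ge> 0"
  shows "L2_norm (hermite_proj k f) \<le> sqrt (18 * pi) ^ CARD('n) * (real k + 1) ^ (2 * CARD('n)) * M"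
proof -
  define W where "W = (\<lambda>x::real^'n. \<Prod>j\<in>UNIV. 18 * (real k + 1)\<^sup>2 * (1 / (1 + (x $ j)\<^sup>2)))"
  define N where "N = (real k + 1) ^ CARD('n)"
  have W: "W x \<ge> 0" for x unfolding W_def by (intro prod_nonneg) auto
  have "has_bochner_integral lborel (\<lambda>x::real^'n. (N * M)\<^sup>2 * W x) ((N * M)\<^sup>2 * (\<Prod>j\<in>(UNIV::'n set). 18 * (real k + 1)\<^sup>2 * pi))"
    unfolding W_def
    by (intro has_bochner_integral_mult_right has_bochner_integral_lborel_prod_vec
        has_bochner_integral_inverse_1_plus_square)
  note int = integral_lebesgue_eq[OF this]
  have le: "(cmod (hermite_proj k f x))\<^sup>2 \<le> (N * M)\<^sup>2 * W x" for x
  proof -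
    have "cmod (hermite_proj k f x) \<le> (\<Sum>\<alpha>\<in>(multi_indices k :: ('n \<Rightarrow> nat) set). M * sqrt (W x))"
      unfolding hermite_proj_def
    proof (rule order_trans[OF norm_sum], rule sum_mono)
      fix \<alpha> :: "'n \<Rightarrow> nat" assume \<alpha>: "\<alpha> \<in> multi_indices k"
      have "\<bar>hermite_fun \<alpha> x\<bar> \<le> sqrt (W x)"
        using hermite_fun_square_le[OF \<alpha>, of x] unfolding W_def by (intro real_le_rsqrt) simp
      then show "cmod (L2_inner f (\<lambda>y. complex_of_real (hermite_fun \<alpha> y)) * complex_of_real (hermite_fun \<alpha> x)) \<le> M * sqrt (W x)"
        unfolding norm_mult norm_of_real using M[OF \<alpha>] \<open>M \<ge> 0\<close> by (intro mult_mono) auto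
    qed
    also have "\<dots> = real (card (multi_indices k :: ('n \<Rightarrow> nat) set)) * (M * sqrt (W x))" by simp
    also have "\<dots> \<le> N * (M * sqrt (W x))"
    proof (rule mult_right_mono)
      have "real (card (multi_indices k :: ('n \<Rightarrow> nat) set)) \<le> real ((k + 1) ^ CARD('n))"
        by (intro of_nat_mono card_multi_indices_le)
      then show "real (card (multi_indices k :: ('n \<Rightarrow> nat) set)) \<le> N" by (simp add: N_def add.commute)
    qed (use \<open>M \<ge> 0\<close> W in auto)
    finally have "(cmod (hermite_proj k f x))\<^sup>2 \<le> (N * (M * sqrt (W x)))\<^sup>2"
      by (intro power_mono) auto
    then show ?thesis using W[of x] by (simp add: power_mult_distrib mult.assoc)
  qed
  have "(LINT x|lebesgue. (cmod (hermite_proj k f x))\<^sup>2) \<le> (LINT x|lebesgue. (N * M)\<^sup>2 * W x)"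
    using W by (intro integral_mono' int le) auto
  also have "\<dots> = (N * M)\<^sup>2 * (18 * (real k + 1)\<^sup>2 * pi) ^ CARD('n)"
    unfolding int(2) by simp
  also have "\<dots> = (sqrt (18 * pi) ^ CARD('n) * (real k + 1) ^ (2 * CARD('n)) * M)\<^sup>2"
  proof -
    have "(sqrt (18 * pi) ^ CARD('n))\<^sup>2 = (18 * pi) ^ CARD('n)"
      by (subst power_mult [symmetric], subst mult.commute, subst power_mult) simp
    then show ?thesis
      unfolding N_def power_mult_distrib by (simp add: power_mult_distrib flip: power_mult power_add)
  qed
  finally show ?thesis
    unfolding L2_norm_def using \<open>M \<ge> 0\<close> by (intro real_le_lsqrt) auto
qed

section \<open>Comparison of the exponential rates and conclusion\<close>

lemma polynomial_times_geometric_bounded: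
  fixes q :: real
  assumes "0 < q" "q < 1"
  obtains D where "D > 0" "\<And>k. (real k + 1) ^ m * q ^ k \<le> D"
proof -
  have "(\<lambda>k. (real k + 1) ^ m * q ^ k) \<longlonglongrightarrow> 0"
    using assms by real_asymp
  then have "Bseq (\<lambda>k. (real k + 1) ^ m * q ^ k)" by (intro convergent_imp_Bseq convergentI)
  then obtain D where "D > 0" "\<And>k. norm ((real k + 1) ^ m * q ^ k) \<le> D"
    by (auto elim: BseqE)
  then show ?thesis using that[of D] by (auto simp: abs_le_iff)
qed

text \<open>With \<open>E = exp (- 4 * s)\<close> the equation for \<open>tanh\<close> reads
  \<open>(1 - E) / (1 + E) = a / 2\<close>, that is \<open>E = (2 - a) / (2 + a)\<close>. The fourth
  power of the claim then becomes \<open>2 + a < (2 - a) * (1 + a)\<^sup>2\<close>.\<close>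

lemma sqrt_inverse_times_exp_less_1:
  fixes a s :: real
  assumes a: "0 < a" "a < 1" and s: "tanh (2 * s) = a / 2"
  shows "sqrt (1 / (1 + a)) * exp s < 1"
proof -
  define E where "E = exp (- 4 * s)"
  have E: "E > 0" by (simp add: E_def)
  have "(1 - E) / (1 + E) = a / 2"
    using s tanh_real_altdef[of "2 * s"] by (simp add: E_def)
  then have "(1 - E) * 2 = a * (1 + E)"
    using E by (subst (asm) frac_eq_eq) auto
  then have "E * (2 + a) = 2 - a" by (simp add: algebra_simps)
  \<comment> \<open>The right side minus the left side is
    \<open>a * (2 - a\<^sup>2)\<close>.\<close>
  moreover have "2 + a < (2 - a) * (1 + a)\<^sup>2"
  proof -
    have "a * a < 2" using a mult_strict_mono[of a 1 a 1] by simp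
    then have "a * (a * a) < a * 2" using a by (intro mult_strict_left_mono) auto
    then show ?thesis by (simp add: power2_eq_square algebra_simps)
  qed
  ultimately have "1 * (2 + a) < E * (1 + a)\<^sup>2 * (2 + a)"
    by (metis mult.commute mult.left_commute mult_1)
  then have "1 < E * (1 + a)\<^sup>2" using a by (simp only: mult_less_cancel_right_pos)
  then have "(1 / (1 + a))\<^sup>2 * exp (4 * s) < 1"
    using a by (simp add: E_def exp_minus divide_simps power_divide mult_ac)
  moreover have "(1 / (1 + a))\<^sup>2 * exp (4 * s) = (sqrt (1 / (1 + a)) * exp s) ^ 4"
  proof -
    have "sqrt (1 / (1 + a)) ^ 4 = ((sqrt (1 / (1 + a)))\<^sup>2)\<^sup>2" by (simp only: power_mult [symmetric]) simp
    then have "sqrt (1 / (1 + a)) ^ 4 = (1 / (1 + a))\<^sup>2" using a by simp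
    then show ?thesis by (simp add: power_mult_distrib exp_of_nat_mult [symmetric])
  qed
  ultimately have "(sqrt (1 / (1 + a)) * exp s) ^ 4 < 1 ^ 4" by simp
  then show ?thesis by (rule power_less_imp_less_base) simp
qed

theorem theorem1p3:
  fixes f :: "real ^ 'n::finite \<Rightarrow> complex"
    and C0 a s :: real
  assumes "integrable lebesgue f"
    and "C0 > 0"
    and "0 < a" and "a < 1"
    and "\<And>x. cmod (f x) \<le> C0 * exp (- (1/2) * a * (norm x)\<^sup>2)"
    and "\<And>x. cmod (fourier f x) \<le> C0 * exp (- (1/2) * a * (norm x)\<^sup>2)"
    and "s > 0" and "tanh (2 * s) = a / 2"
  shows "\<exists>C>0. \<forall>k::nat. L2_norm (hermite_proj k f) \<le>
           C * real (2 * k + CARD('n)) powr ((real CARD('n) - 1) / 4)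
             * exp (- real (2 * k + CARD('n)) * s / 2)"
proof -
  define n where "n = CARD('n)"
  define b where "b = 1 / (1 + a)"
  \<comment> \<open>\<open>q\<close> is the surplus decay:
    \<open>sqrt b ^ k = exp (- k * s) * q ^ k\<close>.\<close>
  define q where "q = sqrt b * exp s"
  define K where "K = C0 * sqrt (2 * pi / (1 + a)) ^ n"
  have b: "b > 0" and K: "K > 0" using assms(2,3) by (simp_all add: b_def K_def)
  have q: "0 < q" "q < 1"
    using b sqrt_inverse_times_exp_less_1[OF assms(3,4,8)] by (simp_all add: q_def b_def)
  \<comment> \<open>Of the exponent \<open>3 * n\<close>, the norm of the projection accounts for
    \<open>2 * n\<close> and the coefficient bound for \<open>n\<close>.\<close>
  obtain D where D: "D > 0" "\<And>k. (real k + 1) ^ (3 * n) * q ^ k \<le> D"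
    by (rule polynomial_times_geometric_bounded[OF q, of "3 * n"]) blast
  \<comment> \<open>The factor \<open>exp (real n * s / 2)\<close> compensates for passing from
    \<open>exp (- k * s)\<close> to \<open>exp (- (2 * k + n) * s / 2)\<close>.\<close>
  define C where "C = sqrt (18 * pi) ^ n * K * 3 ^ n * D * exp (real n * s / 2)"
  have C: "C > 0" using K D by (simp add: C_def)
  have "L2_norm (hermite_proj k f) \<le> C * real (2 * k + n) powr ((real n - 1) / 4) * exp (- real (2 * k + n) * s / 2)" for k
  proof -
    have "L2_norm (hermite_proj k f) \<le> sqrt (18 * pi) ^ n * (real k + 1) ^ (2 * n) * (K * (3 * (real k + 1)) ^ n * sqrt b ^ k)"
      unfolding n_def
    proof (rule L2_norm_hermite_proj_le)
      fix \<alpha> :: "'n \<Rightarrow> nat" assume \<alpha>: "\<alpha> \<in> multi_indices k"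
      show "cmod (L2_inner f (\<lambda>y. complex_of_real (hermite_fun \<alpha> y))) \<le> K * (3 * (real k + 1)) ^ CARD('n) * sqrt b ^ k"
        using cmod_hermite_transform_le_geometric_mean[OF assms(1,3,5,6)]
        by (intro cmod_L2_inner_hermite_fun_le[OF assms(1) b less_imp_le[OF K] _ \<alpha>]) (simp add: K_def b_def n_def)
    qed (use K b in simp)
    also have "\<dots> = sqrt (18 * pi) ^ n * K * 3 ^ n * exp (- real k * s) * ((real k + 1) ^ (3 * n) * q ^ k)"
    proof -
      have "sqrt b ^ k = exp (- real k * s) * q ^ k"
        by (simp add: q_def power_mult_distrib exp_of_nat_mult [symmetric] flip: exp_add)
      moreover have "(real k + 1) ^ (3 * n) = (real k + 1) ^ (2 * n) * (real k + 1) ^ n"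
        by (simp flip: power_add)
      ultimately show ?thesis by (simp only: power_mult_distrib [of 3] mult_ac)
    qed
    also have "\<dots> \<le> sqrt (18 * pi) ^ n * K * 3 ^ n * exp (- real k * s) * D"
      using K by (intro mult_left_mono D(2)) auto
    also have "\<dots> = C * 1 * exp (- real (2 * k + n) * s / 2)"
    proof -
      have "- real k * s = real n * s / 2 + (- real (2 * k + n) * s / 2)"
        by (simp add: field_simps)
      then have "exp (- real k * s) = exp (real n * s / 2) * exp (- real (2 * k + n) * s / 2)"
        by (simp only: exp_add)
      then show ?thesis by (simp add: C_def)
    qed
    \<comment> \<open>Since \<open>n \<ge> 1\<close>, the base is at least 1 and the exponent
      nonnegative, so the inserted power is at least 1.\<close>
    also have "\<dots> \<le> C * real (2 * k + n) powr ((real n - 1) / 4) * exp (- real (2 * k + n) * s / 2)"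
    proof (intro mult_right_mono mult_left_mono)
      have "n \<ge> 1" unfolding n_def by (simp add: Suc_le_eq)
      then show "1 \<le> real (2 * k + n) powr ((real n - 1) / 4)"
        by (intro ge_one_powr_ge_zero) auto
    qed (use C in auto)
    finally show ?thesis .
  qed
  with C show ?thesis unfolding n_def by blast
qed

end
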